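(* The first quadrant Mordell-Gruber spectrum $\mathrm{MG}_2^+$ is a closed set (as a subset of $[0,\infty]$).
   Context: A unimodular lattice in $\mathbb{R}^2$ is $\Lambda=\mathbb{Z}A+\mathbb{Z}B$ with $|\det(A;B)|=1$. A rectangle $[0,x]\times[0,y]$ ($x,y>0$) is admissible in $\Lambda$ if $([0,x]\times[0,y])\cap\Lambda=\{(0,0)\}$. Put $\kappa^+(\Lambda)=\sup xy\in[0,\infty]$, the supremum over all admissible rectangles $[0,x]\times[0,y]$, and $\mathrm{MG}_2^+=\{\kappa^+(\Lambda):\Lambda\text{ a unimodular lattice in }\mathbb{R}^2\}$. *)

theory Defs
  imports "HOL-Analysis.Analysis"
begin

definition int_span2 :: "real^2 \<Rightarrow> real^2 \<Rightarrow> (real^2) set" where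
  "int_span2 A B = {of_int m *\<^sub>R A + of_int n *\<^sub>R B | m n. True}"

definition unimodular_lattice :: "(real^2) set \<Rightarrow> bool" where
  "unimodular_lattice \<Lambda> \<longleftrightarrow>
     (\<exists>A B. \<Lambda> = int_span2 A B \<and> \<bar>det (vector [A, B] :: real^2^2)\<bar> = 1)"

definition admissible :: "(real^2) set \<Rightarrow> real \<Rightarrow> real \<Rightarrow> bool" where
  "admissible \<Lambda> x y \<longleftrightarrow> x > 0 \<and> y > 0 \<and> cbox 0 (vector [x, y]) \<inter> \<Lambda> = {0}"

text \<open>
  Areas are taken in \<^typ>\<open>ennreal\<close>, that is, in the extended half-line from 0 to
  \<open>\<infinity>\<close> with its order topology; the supremum can be infinite.
\<close>

definition kappa_plus :: "(real^2) set \<Rightarrow> ennreal" where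
  "kappa_plus \<Lambda> = (SUP (x, y) \<in> {(x, y). admissible \<Lambda> x y}. ennreal (x * y))"

definition MG2_plus :: "ennreal set" where
  "MG2_plus = {kappa_plus \<Lambda> | \<Lambda>. unimodular_lattice \<Lambda>}"

end

theory Submission
  imports Defs
begin

text \<open>
  Let lattices \<open>\<Lambda>\<^sub>n\<close> have values \<open>\<kappa>\<^sup>+(\<Lambda>\<^sub>n)\<close> converging to \<open>S\<close>; a lattice with value exactly
  \<open>S\<close> is wanted. The difficulty is that the space of lattices is not compact, and that admissible
  rectangles contain their edges on the axes, so that \<open>\<kappa>\<^sup>+\<close> is not continuous. One observation
  settles both problems: a lattice vector \<open>v\<close> with coordinates of strictly opposite signs forces
  \<open>\<kappa>\<^sup>+(\<Lambda>) \<ge> 1 / (4 \<bar>v\<^sub>1 v\<^sub>2\<bar>)\<close> (lemma \<open>kappa_plus_ge_mixed_sign\<close>), since the lattice lies on lines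
  parallel to \<open>v\<close>, and the first of them off the origin cuts a triangle of area at least \<open>1 / (2 \<bar>v\<^sub>1 v\<^sub>2\<bar>)\<close>
  from the quadrant. So a bound on \<open>\<kappa>\<^sup>+\<close> keeps \<open>\<bar>v\<^sub>1 v\<^sub>2\<bar>\<close> away from 0 for all such \<open>v\<close>.

  Suppose that \<open>S\<close> is finite. It is at least \<open>1/4\<close>, as every \<open>\<kappa>\<^sup>+(\<Lambda>)\<close> is
  (\<open>kappa_plus_ge_quarter\<close>). A diagonal map \<open>(x, y) \<mapsto> (t x, y / t)\<close> preserves \<open>\<kappa>\<^sup>+\<close> and turns
  a nearly optimal rectangle into a square, so that \<open>\<Lambda>\<^sub>n\<close> may be assumed to admit a square with
  side \<open>r\<^sub>n\<close>, where \<open>r\<^sub>n\<close> tends to \<open>\<surd>S\<close>. Then \<open>\<Lambda>\<^sub>n\<close> has no short vectors: a vector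
  with both signs has a product bounded away from 0, and any other vector lies, up to sign, in the
  closed quadrant, outside the square. Hence \<open>\<Lambda>\<^sub>n\<close> has a bounded basis (\<open>bounded_basis\<close>), and a
  subsequence converges to a lattice \<open>\<Lambda>\<close>.

  A rectangle admissible in \<open>\<Lambda>\<close> is eventually admissible in \<open>\<Lambda>\<^sub>n\<close>, so \<open>\<kappa>\<^sup>+(\<Lambda>) \<le> S\<close>. Conversely, if
  a nonzero \<open>v \<in> \<Lambda>\<close> were in a square with side smaller than \<open>\<surd>S\<close>, then nearby vectors of \<open>\<Lambda>\<^sub>n\<close>
  could avoid the square with side \<open>r\<^sub>n\<close> only by slipping across an axis; they would then have
  coordinates with opposite signs and a product tending to \<open>v\<^sub>1 v\<^sub>2 \<ge> 0\<close>, which the bound above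
  excludes (\<open>kappa_plus_limit\<close>).

  For \<open>S = \<infinity>\<close> the same observation shows that \<open>\<kappa>\<^sup>+(\<Lambda>) = \<infinity>\<close> as soon as \<open>\<Lambda>\<close> has mixed-sign vectors
  with arbitrarily small product of coordinates; such a lattice comes from a real number that is very
  well approximated by smaller rationals.
\<close>

section \<open>Planar lattices and their bases\<close>

definition wedge :: "real^2 \<Rightarrow> real^2 \<Rightarrow> real" where
  "wedge u v = u$1 * v$2 - u$2 * v$1"

definition lattice_basis :: "(real^2) set \<Rightarrow> real^2 \<Rightarrow> real^2 \<Rightarrow> bool" where
  "lattice_basis \<Lambda> A B \<longleftrightarrow> \<Lambda> = int_span2 A B \<and> \<bar>wedge A B\<bar> = 1"

lemma unimodular_lattice_iff_basis:
  "unimodular_lattice \<Lambda> \<longleftrightarrow> (\<exists>A B. lattice_basis \<Lambda> A B)"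
  by (simp add: unimodular_lattice_def lattice_basis_def wedge_def det_2 algebra_simps)

lemma inner_2: "(u :: real^2) \<bullet> v = u$1 * v$1 + u$2 * v$2"
  by (simp add: inner_vec_def sum_2)

lemma wedge_combination:
  "wedge (a *\<^sub>R A + b *\<^sub>R B) (c *\<^sub>R A + d *\<^sub>R B) = (a * d - b * c) * wedge A B"
  by (simp add: wedge_def algebra_simps)

lemma wedge_coordinates:
  "wedge (a *\<^sub>R A + b *\<^sub>R B) B = a * wedge A B"
  "wedge A (a *\<^sub>R A + b *\<^sub>R B) = b * wedge A B"
  by (simp_all add: wedge_def algebra_simps)

lemma abs_wedge_le: "\<bar>wedge u v\<bar> \<le> (\<bar>u$1\<bar> + \<bar>u$2\<bar>) * norm v"
proof -
  have "\<bar>wedge u v\<bar> \<le> \<bar>u$1\<bar> * \<bar>v$2\<bar> + \<bar>u$2\<bar> * \<bar>v$1\<bar>"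
    unfolding wedge_def by (metis abs_mult abs_triangle_ineq4)
  also have "\<dots> \<le> \<bar>u$1\<bar> * norm v + \<bar>u$2\<bar> * norm v"
    by (intro add_mono mult_left_mono component_le_norm_cart) auto
  finally show ?thesis by (simp add: algebra_simps)
qed

lemma tendsto_wedge:
  assumes "(f \<longlongrightarrow> A) F" "(g \<longlongrightarrow> B) F"
  shows "((\<lambda>n. wedge (f n) (g n)) \<longlongrightarrow> wedge A B) F"
  unfolding wedge_def by (intro tendsto_intros assms)

text \<open>
  With \<open>\<bar>wedge A B\<bar> = 1\<close> this bounds the second vector of a basis by the first one and the inner product.
\<close>

lemma lagrange_identity_2: "(A \<bullet> A) * (B \<bullet> B) = (wedge A B)\<^sup>2 + (A \<bullet> B)\<^sup>2"
  by (simp add: inner_2 wedge_def power2_eq_square algebra_simps)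

lemma mem_cbox_quadrant:
  "v \<in> cbox 0 (vector [x, y] :: real^2) \<longleftrightarrow> 0 \<le> v$1 \<and> v$1 \<le> x \<and> 0 \<le> v$2 \<and> v$2 \<le> y"
  by (auto simp: mem_box_cart forall_2)

lemma vec2_eq_0_iff: "(v :: real^2) = 0 \<longleftrightarrow> v$1 = 0 \<and> v$2 = 0"
  by (simp add: vec_eq_iff forall_2)

lemma int_span2_intro: "of_int m *\<^sub>R A + of_int n *\<^sub>R B \<in> int_span2 A B"
  unfolding int_span2_def by blast

lemma zero_in_int_span2: "0 \<in> int_span2 A B"
  using int_span2_intro[of 0 A 0 B] by simp

lemma int_span2_uminus:
  assumes "v \<in> int_span2 A B" shows "- v \<in> int_span2 A B"
proof -
  obtain m n where "v = of_int m *\<^sub>R A + of_int n *\<^sub>R B"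
    using assms unfolding int_span2_def by blast
  then have "- v = of_int (- m) *\<^sub>R A + of_int (- n) *\<^sub>R B" by simp
  then show ?thesis using int_span2_intro by metis
qed

lemma admissible_iff:
  assumes "0 \<in> \<Lambda>"
  shows "admissible \<Lambda> x y \<longleftrightarrow> x > 0 \<and> y > 0 \<and>
    (\<forall>v\<in>\<Lambda>. 0 \<le> v$1 \<longrightarrow> v$1 \<le> x \<longrightarrow> 0 \<le> v$2 \<longrightarrow> v$2 \<le> y \<longrightarrow> v = 0)"
proof -
  have "cbox 0 (vector [x, y]) \<inter> \<Lambda> = {0} \<longleftrightarrow>
    (\<forall>v\<in>\<Lambda>. 0 \<le> v$1 \<longrightarrow> v$1 \<le> x \<longrightarrow> 0 \<le> v$2 \<longrightarrow> v$2 \<le> y \<longrightarrow> v = 0)" if "x > 0" "y > 0"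
    using that assms by (auto simp: set_eq_iff mem_cbox_quadrant)
  then show ?thesis unfolding admissible_def by blast
qed

lemma kappa_plus_ge:
  assumes "admissible \<Lambda> x y" shows "ennreal (x * y) \<le> kappa_plus \<Lambda>"
  unfolding kappa_plus_def using assms by (intro SUP_upper2[of "(x, y)"]) auto

lemma kappa_plus_le:
  assumes "\<And>x y. admissible \<Lambda> x y \<Longrightarrow> ennreal (x * y) \<le> c"
  shows "kappa_plus \<Lambda> \<le> c"
  unfolding kappa_plus_def using assms by (auto intro!: SUP_least)

lemma less_kappa_plusD:
  assumes "c < kappa_plus \<Lambda>"
  obtains x y where "admissible \<Lambda> x y" "c < ennreal (x * y)"
  using assms unfolding kappa_plus_def less_SUP_iff by auto

lemma lattice_zero: "lattice_basis \<Lambda> A B \<Longrightarrow> 0 \<in> \<Lambda>"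
  by (simp add: lattice_basis_def zero_in_int_span2)

lemma lattice_uminus: "lattice_basis \<Lambda> A B \<Longrightarrow> v \<in> \<Lambda> \<Longrightarrow> - v \<in> \<Lambda>"
  by (simp add: lattice_basis_def int_span2_uminus)

text \<open>
  This integrality is what makes the lattice lie on equally spaced lines parallel to any of its vectors:
  a lattice vector \<open>u\<close> with \<open>\<bar>wedge v u\<bar> < 1\<close> is parallel to \<open>v\<close>.
\<close>

lemma lattice_wedge_Ints:
  assumes "lattice_basis \<Lambda> A B" "u \<in> \<Lambda>" "v \<in> \<Lambda>"
  shows "wedge u v \<in> \<int>"
proof -
  obtain m n m' n' where
    "u = of_int m *\<^sub>R A + of_int n *\<^sub>R B" "v = of_int m' *\<^sub>R A + of_int n' *\<^sub>R B"
    using assms unfolding lattice_basis_def int_span2_def by blast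
  then have "wedge u v = of_int (m * n' - n * m') * wedge A B"
    by (simp only: wedge_combination) simp
  moreover have "wedge A B \<in> \<int>"
  proof -
    have "wedge A B = 1 \<or> wedge A B = - 1"
      using assms(1) by (auto simp: lattice_basis_def)
    then show ?thesis by auto
  qed
  ultimately show ?thesis by simp
qed

lemma Ints_abs_less_1: "(x :: real) \<in> \<int> \<Longrightarrow> \<bar>x\<bar> < 1 \<Longrightarrow> x = 0"
  by (auto elim!: Ints_cases)

section \<open>Lattice vectors with coordinates of opposite signs\<close>

text \<open>
  For \<open>v = (p, - q)\<close>, every \<open>u\<close> in the closed quadrant has \<open>wedge v u = p u\<^sub>2 + q u\<^sub>1 \<ge> 0\<close>. Inside
  \<open>[0, 1 / (2 q)) \<times> [0, 1 / (2 p))\<close> this is an integer below 1, hence 0, which leaves only \<open>u = 0\<close>.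
  The closed rectangles inside this half-open one have areas arbitrarily close to \<open>1 / (4 p q)\<close>.
\<close>

lemma kappa_plus_ge_mixed_sign_aux:
  assumes L: "lattice_basis \<Lambda> A B" and v: "v \<in> \<Lambda>" "v$1 > 0" "v$2 < 0"
  shows "ennreal (1 / (4 * (v$1 * - v$2))) \<le> kappa_plus \<Lambda>"
proof -
  define p q where "p = v$1" and "q = - v$2"
  have pq: "p > 0" "q > 0" using v by (auto simp: p_def q_def)
  have adm: "admissible \<Lambda> x y" if xy: "x > 0" "y > 0" "x < 1 / (2 * q)" "y < 1 / (2 * p)" for x y
    unfolding admissible_iff[OF lattice_zero[OF L]]
  proof (intro conjI ballI impI)
    fix u assume u: "u \<in> \<Lambda>" "0 \<le> u$1" "u$1 \<le> x" "0 \<le> u$2" "u$2 \<le> y"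
    have w: "wedge v u = p * u$2 + q * u$1" by (simp add: wedge_def p_def q_def)
    have "q * u$1 \<le> q * x" "p * u$2 \<le> p * y" using u pq by auto
    moreover have "q * x < 1/2" "p * y < 1/2" using xy pq by (auto simp: field_simps)
    moreover have nn: "0 \<le> q * u$1" "0 \<le> p * u$2" using u pq by auto
    ultimately have "wedge v u = 0"
      using lattice_wedge_Ints[OF L v(1) u(1)] w by (intro Ints_abs_less_1) auto
    then have "q * u$1 = 0" "p * u$2 = 0" using nn w by linarith+
    then show "u = 0" using pq by (simp add: vec2_eq_0_iff)
  qed (use xy in auto)
  show ?thesis
  proof (rule ccontr)
    assume "\<not> ?thesis"
    then have lt: "kappa_plus \<Lambda> < ennreal (1 / (4 * (p * q)))" by (simp add: p_def q_def)
    define l where "l = enn2real (kappa_plus \<Lambda>)"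
    have kl: "kappa_plus \<Lambda> = ennreal l" "l \<ge> 0"
      using lt unfolding l_def by (auto simp: ennreal_enn2real_if top_unique)
    then have l1: "4 * (p * q) * l < 1"
      using lt pq by (simp add: ennreal_less_iff field_simps)
    \<comment> \<open>A shrinking factor whose square still exceeds the ratio of the assumed value to the claimed one.\<close>
    obtain t where t: "4 * (p * q) * l < t\<^sup>2" "0 < t" "t < 1"
    proof -
      define s where "s = sqrt (4 * (p * q) * l)"
      have s: "s\<^sup>2 = 4 * (p * q) * l" "0 \<le> s" "s < 1" using l1 kl pq by (auto simp: s_def)
      have "s\<^sup>2 < ((s+1)/2)\<^sup>2" using s by (intro power_strict_mono) auto
      then show ?thesis using that[of "(s+1)/2"] s by auto
    qed
    have "admissible \<Lambda> (t / (2 * q)) (t / (2 * p))"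
      using adm t pq by (simp add: divide_strict_right_mono)
    from kappa_plus_ge[OF this] have "ennreal (t / (2 * q) * (t / (2 * p))) \<le> ennreal l"
      by (simp only: kl)
    then have "t / (2 * q) * (t / (2 * p)) \<le> l" using kl by simp
    then have "t\<^sup>2 \<le> 4 * (p * q) * l" using pq by (simp add: field_simps power2_eq_square)
    then show False using t by simp
  qed
qed

lemma kappa_plus_ge_mixed_sign:
  assumes L: "lattice_basis \<Lambda> A B" and v: "v \<in> \<Lambda>" "v$1 * v$2 < 0"
  shows "ennreal (1 / (4 * \<bar>v$1 * v$2\<bar>)) \<le> kappa_plus \<Lambda>"
proof (cases "v$1 > 0")
  case True
  then have "v$2 < 0" using v by (simp add: mult_less_0_iff)
  then show ?thesis using kappa_plus_ge_mixed_sign_aux[OF L v(1)] True v by simp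
next
  case False
  then have "v$1 < 0" "v$2 > 0" using v by (auto simp: mult_less_0_iff)
  then show ?thesis
    using kappa_plus_ge_mixed_sign_aux[OF L lattice_uminus[OF L v(1)]] v by simp
qed

text \<open>
  The form in which the bound is used: vectors of mixed sign cannot approach the coordinate axes while
  \<open>\<kappa>\<^sup>+\<close> stays bounded.
\<close>

lemma mixed_sign_product_ge:
  assumes L: "lattice_basis \<Lambda> A B" and "v \<in> \<Lambda>" "v$1 * v$2 < 0"
    and K: "kappa_plus \<Lambda> \<le> ennreal C" "C > 0"
  shows "v$1 * v$2 \<le> - 1 / (4 * C)"
proof -
  have "ennreal (1 / (4 * \<bar>v$1 * v$2\<bar>)) \<le> ennreal C"
    using kappa_plus_ge_mixed_sign[OF assms(1-3)] K(1) by (rule order_trans)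
  then have "1 / (4 * \<bar>v$1 * v$2\<bar>) \<le> C" using K by simp
  moreover have "\<bar>v$1 * v$2\<bar> = - (v$1 * v$2)" using assms(3) by simp
  moreover have "4 * - (v$1 * v$2) > 0" using assms(3) by simp
  ultimately have "1 \<le> C * (4 * - (v$1 * v$2))"
    by (simp only: pos_divide_le_eq)
  then show ?thesis using K by (simp add: field_simps)
qed

section \<open>Reduced bases\<close>

lemma lattice_basis_swap: "lattice_basis \<Lambda> A B \<Longrightarrow> lattice_basis \<Lambda> B A"
proof -
  have "int_span2 A B \<subseteq> int_span2 B A" for A B
  proof
    fix x assume "x \<in> int_span2 A B"
    then obtain m n where "x = of_int m *\<^sub>R A + of_int n *\<^sub>R B"
      unfolding int_span2_def by blast
    then have "x = of_int n *\<^sub>R B + of_int m *\<^sub>R A" by simp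
    then show "x \<in> int_span2 B A" by (simp only: int_span2_intro)
  qed
  then have "int_span2 A B = int_span2 B A" by blast
  moreover have "wedge B A = - wedge A B" by (simp add: wedge_def)
  ultimately show "lattice_basis \<Lambda> A B \<Longrightarrow> lattice_basis \<Lambda> B A"
    by (simp add: lattice_basis_def)
qed

lemma lattice_basis_shear:
  assumes "lattice_basis \<Lambda> A B"
  shows "lattice_basis \<Lambda> A (B + of_int k *\<^sub>R A)"
proof -
  have 1: "of_int m *\<^sub>R A + of_int n *\<^sub>R (B + of_int k *\<^sub>R A)
      = of_int (m + n * k) *\<^sub>R A + of_int n *\<^sub>R B" for m n
    by (simp add: algebra_simps)
  have 2: "of_int m *\<^sub>R A + of_int n *\<^sub>R B
      = of_int (m - n * k) *\<^sub>R A + of_int n *\<^sub>R (B + of_int k *\<^sub>R A)" for m n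
    by (simp add: algebra_simps)
  have "int_span2 A (B + of_int k *\<^sub>R A) = int_span2 A B"
  proof (intro equalityI subsetI)
    fix x assume "x \<in> int_span2 A (B + of_int k *\<^sub>R A)"
    then obtain m n where "x = of_int m *\<^sub>R A + of_int n *\<^sub>R (B + of_int k *\<^sub>R A)"
      unfolding int_span2_def by blast
    then show "x \<in> int_span2 A B" by (simp only: 1 int_span2_intro)
  next
    fix x assume "x \<in> int_span2 A B"
    then obtain m n where "x = of_int m *\<^sub>R A + of_int n *\<^sub>R B"
      unfolding int_span2_def by blast
    then show "x \<in> int_span2 A (B + of_int k *\<^sub>R A)"
      by (simp only: 2 int_span2_intro)
  qed
  moreover have "wedge A (B + of_int k *\<^sub>R A) = wedge A B"
    by (simp add: wedge_def algebra_simps)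
  ultimately show ?thesis using assms by (simp add: lattice_basis_def)
qed

text \<open>
  Gauss reduction with an infimum in place of the descent: either some member \<open>A\<close> of a basis has
  \<open>\<bar>A\<bar>\<^sup>2 < 2\<close>, or \<open>A\<close> can be chosen such that \<open>\<bar>A\<bar>\<^sup>2\<close> is minimal among members of bases up to a factor of 2.
  Subtracting from \<open>B\<close> the right multiple of \<open>A\<close> gives \<open>B'\<close> with small inner product. It is itself a member
  of a basis, so in the second case \<open>\<bar>A\<bar>\<^sup>2 \<le> 2 \<bar>B'\<bar>\<^sup>2\<close>, and Lagrange's identity turns this into a bound for \<open>\<bar>A\<bar>\<close>.
\<close>

lemma reduced_basis:
  assumes "unimodular_lattice \<Lambda>"
  obtains A B where "lattice_basis \<Lambda> A B" "A \<bullet> A \<le> 2" "\<bar>A \<bullet> B\<bar> \<le> (A \<bullet> A) / 2"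
proof -
  define S where "S = {A \<bullet> A | A. \<exists>B. lattice_basis \<Lambda> A B}"
  have ne: "S \<noteq> {}" using assms unfolding S_def unimodular_lattice_iff_basis by blast
  have bdd: "bdd_below S" unfolding S_def by (intro bdd_belowI[of _ 0]) auto
  have Inf0: "Inf S \<ge> 0" using ne by (intro cInf_greatest) (auto simp: S_def)
  \<comment> \<open>The infimum might be 0 a priori; then any vector with squared length below 2 will do.\<close>
  have "Inf S < max 2 (2 * Inf S)" using Inf0 by (auto simp: max_def)
  then obtain A B where L: "lattice_basis \<Lambda> A B" and A: "A \<bullet> A < max 2 (2 * Inf S)"
    using cInf_lessD[OF ne] unfolding S_def by blast
  have A0: "A \<bullet> A > 0" using L by (auto simp: lattice_basis_def wedge_def)
  define k where "k = - round ((A \<bullet> B) / (A \<bullet> A))"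
  define B' where "B' = B + of_int k *\<^sub>R A"
  have L': "lattice_basis \<Lambda> A B'" unfolding B'_def by (rule lattice_basis_shear[OF L])
  have "A \<bullet> B' = ((A \<bullet> B) / (A \<bullet> A) - of_int (round ((A \<bullet> B) / (A \<bullet> A)))) * (A \<bullet> A)"
    using A0 by (simp add: B'_def k_def inner_diff_right left_diff_distrib)
  moreover have "\<bar>(A \<bullet> B) / (A \<bullet> A) - of_int (round ((A \<bullet> B) / (A \<bullet> A)))\<bar> \<le> 1/2"
    using of_int_round_abs_le[of "(A \<bullet> B) / (A \<bullet> A)"] by (simp add: abs_minus_commute)
  ultimately have d: "\<bar>A \<bullet> B'\<bar> \<le> (A \<bullet> A) / 2"
    using A0 by (simp add: abs_mult mult_right_mono[of _ "1/2" "A \<bullet> A", simplified])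
  have "A \<bullet> A \<le> 2"
  proof (rule ccontr)
    assume big: "\<not> A \<bullet> A \<le> 2"
    have "B' \<bullet> B' \<in> S" unfolding S_def using lattice_basis_swap[OF L'] by blast
    then have "Inf S \<le> B' \<bullet> B'" using bdd by (rule cInf_lower)
    then have "A \<bullet> A \<le> 2 * (B' \<bullet> B')" using A big by auto
    then have "(A \<bullet> A) * (A \<bullet> A) \<le> 2 * ((A \<bullet> A) * (B' \<bullet> B'))"
      using mult_left_mono[of "A \<bullet> A" "2 * (B' \<bullet> B')" "A \<bullet> A"] A0 by simp
    moreover have "(wedge A B')\<^sup>2 = 1"
      using L' by (metis lattice_basis_def one_power2 power2_abs)
    moreover have "(A \<bullet> B')\<^sup>2 \<le> ((A \<bullet> A) / 2)\<^sup>2"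
      using d A0 by (simp add: abs_le_square_iff[symmetric])
    ultimately have "(A \<bullet> A)\<^sup>2 \<le> 2 + (A \<bullet> A)\<^sup>2 / 2"
      unfolding lagrange_identity_2[of A B'] by (simp add: power2_eq_square)
    moreover have "(A \<bullet> A)\<^sup>2 > 2\<^sup>2" using big by (intro power_strict_mono) auto
    ultimately show False by simp
  qed
  then show ?thesis using that L' d by blast
qed

text \<open>
  A primitive vector \<open>A\<close> with \<open>\<bar>A\<^sub>1 A\<^sub>2\<bar> \<le> 1\<close> is provided by the reduced basis. If its coordinates have opposite
  signs, the triangle bound applies. Otherwise it may be taken in the closed quadrant, and the rectangle
  \<open>[0, A\<^sub>1 / 2] \<times> [0, 1 / (2 A\<^sub>1)]\<close> is too narrow for a lattice vector off the line of \<open>A\<close> and, as \<open>A\<close> is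
  primitive, too short for one on that line. If \<open>A\<^sub>1 = 0\<close>, the coordinates change roles.
\<close>

lemma kappa_plus_ge_quarter:
  assumes "unimodular_lattice \<Lambda>"
  shows "ennreal (1/4) \<le> kappa_plus \<Lambda>"
proof -
  obtain A0 B where L0: "lattice_basis \<Lambda> A0 B" and A2: "A0 \<bullet> A0 \<le> 2"
    using reduced_basis[OF assms] by blast
  have "\<bar>A0$1 * A0$2\<bar> \<le> 1"
  proof -
    have "0 \<le> (\<bar>A0$1\<bar> - \<bar>A0$2\<bar>)\<^sup>2" by simp
    then have "2 * (\<bar>A0$1\<bar> * \<bar>A0$2\<bar>) \<le> A0 \<bullet> A0"
      by (simp add: inner_2 power2_diff) (simp add: power2_eq_square)
    then show ?thesis using A2 by (simp add: abs_mult)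
  qed
  show ?thesis
  proof (cases "A0$1 * A0$2 < 0")
    case True
    have "A0 \<in> \<Lambda>" using L0 int_span2_intro[of 1 A0 0 B] by (simp add: lattice_basis_def)
    then have "ennreal (1 / (4 * \<bar>A0$1 * A0$2\<bar>)) \<le> kappa_plus \<Lambda>"
      using kappa_plus_ge_mixed_sign[OF L0] True by blast
    moreover have "1/4 \<le> 1 / (4 * \<bar>A0$1 * A0$2\<bar>)"
      using \<open>\<bar>A0$1 * A0$2\<bar> \<le> 1\<close> True by (intro divide_left_mono) auto
    ultimately show ?thesis using ennreal_leI order_trans by blast
  next
    case False
    define A where "A = (if A0$1 < 0 \<or> A0$2 < 0 then - A0 else A0)"
    have nn: "A$1 \<ge> 0" "A$2 \<ge> 0" "A$1 * A$2 \<le> 1"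
      using False \<open>\<bar>A0$1 * A0$2\<bar> \<le> 1\<close>
      by (auto simp: A_def not_less zero_le_mult_iff)
    have An0: "A \<noteq> 0" using L0 by (auto simp: A_def lattice_basis_def wedge_def)
    \<comment> \<open>Primitivity: a lattice vector on the line of A is an integer multiple of A.\<close>
    have prim: "v = 0" if v: "v \<in> \<Lambda>" "\<bar>wedge A v\<bar> < 1" "0 \<le> v$1" "0 \<le> v$2"
        "v$1 < A$1 \<or> v$2 < A$2" for v
    proof -
      obtain m n where mn: "v = of_int m *\<^sub>R A0 + of_int n *\<^sub>R B"
        using v L0 unfolding lattice_basis_def int_span2_def by blast
      have "wedge A0 v = of_int n * wedge A0 B"
        using wedge_combination[of 1 A0 0 B "of_int m" "of_int n"] by (simp add: mn)
      moreover have "\<bar>wedge A v\<bar> = \<bar>wedge A0 v\<bar>" by (auto simp: A_def wedge_def abs_if)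
      ultimately have "\<bar>real_of_int n\<bar> < 1"
        using v L0 by (simp add: lattice_basis_def abs_mult)
      then have "n = 0" by simp
      define k where "k = (if A0$1 < 0 \<or> A0$2 < 0 then - m else m)"
      have k: "v = of_int k *\<^sub>R A" using mn \<open>n = 0\<close> by (simp add: k_def A_def)
      have "k < 1"
      proof (rule ccontr)
        assume "\<not> k < 1"
        then have "real_of_int k \<ge> 1" by simp
        then have "A$1 \<le> v$1" "A$2 \<le> v$2"
          using nn k mult_right_mono[of 1 "real_of_int k"] by auto
        then show False using v by linarith
      qed
      moreover have "k \<ge> 0"
      proof (rule ccontr)
        assume "\<not> k \<ge> 0"
        then have "real_of_int k < 0" by simp
        then have "A$1 = 0" "A$2 = 0"
          using nn k v by (auto simp: zero_le_mult_iff)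
        then show False using An0 by (simp add: vec2_eq_0_iff)
      qed
      ultimately have "k = 0" by simp
      then show ?thesis using k by simp
    qed
    have "\<exists>x y. admissible \<Lambda> x y \<and> x * y = 1/4"
    proof (cases "A$1 > 0")
      case True
      have "admissible \<Lambda> (A$1 / 2) (1 / (2 * A$1))"
        unfolding admissible_iff[OF lattice_zero[OF L0]]
      proof (intro conjI ballI impI)
        fix v assume v: "v \<in> \<Lambda>" "0 \<le> v$1" "v$1 \<le> A$1/2" "0 \<le> v$2" "v$2 \<le> 1 / (2 * A$1)"
        have "A$2 * v$1 \<le> A$2 * (A$1 / 2)" using v nn by (intro mult_left_mono) auto
        then have a: "A$2 * v$1 \<le> 1/2" using nn by (simp add: mult.commute)
        have b: "A$1 * v$2 \<le> 1/2" using v True by (simp add: field_simps)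
        have c: "0 \<le> A$2 * v$1" "0 \<le> A$1 * v$2" using v nn by auto
        have "\<bar>wedge A v\<bar> < 1" unfolding wedge_def using a b c by linarith
        then show "v = 0" using prim v True by auto
      qed (use True in auto)
      then show ?thesis using True by (intro exI conjI) (auto simp: field_simps)
    next
      case False
      then have A: "A$1 = 0" "A$2 > 0" using nn An0 by (auto simp: vec2_eq_0_iff)
      have "admissible \<Lambda> (1 / (2 * A$2)) (A$2 / 2)"
        unfolding admissible_iff[OF lattice_zero[OF L0]]
      proof (intro conjI ballI impI)
        fix v assume v: "v \<in> \<Lambda>" "0 \<le> v$1" "v$1 \<le> 1 / (2 * A$2)" "0 \<le> v$2" "v$2 \<le> A$2/2"
        have a: "A$2 * v$1 \<le> 1/2" using v A by (simp add: field_simps)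
        have c: "0 \<le> A$2 * v$1" using v nn by auto
        have "\<bar>wedge A v\<bar> < 1" unfolding wedge_def using a A c by simp
        then show "v = 0" using prim v A by auto
      qed (use A in auto)
      then show ?thesis using A by (intro exI conjI) (auto simp: field_simps)
    qed
    then obtain x y where "admissible \<Lambda> x y" "x * y = 1/4" by blast
    with kappa_plus_ge[of \<Lambda> x y] show ?thesis by (simp only:)
  qed
qed

section \<open>Normalisation by the diagonal flow\<close>

definition squeeze :: "real \<Rightarrow> real^2 \<Rightarrow> real^2" where
  "squeeze t v = vector [t * v$1, v$2 / t]"

lemma squeeze_nth [simp]: "squeeze t v $ 1 = t * v$1" "squeeze t v $ 2 = v$2 / t"
  by (simp_all add: squeeze_def)

lemma squeeze_combination:
  "squeeze t (a *\<^sub>R u + b *\<^sub>R v) = a *\<^sub>R squeeze t u + b *\<^sub>R squeeze t v"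
  by (simp add: vec_eq_iff forall_2 add_divide_distrib algebra_simps)

lemma lattice_basis_squeeze:
  assumes "lattice_basis \<Lambda> A B" "t > 0"
  shows "lattice_basis (squeeze t ` \<Lambda>) (squeeze t A) (squeeze t B)"
proof -
  have "squeeze t ` int_span2 A B = int_span2 (squeeze t A) (squeeze t B)"
  proof (intro equalityI subsetI)
    fix w assume "w \<in> squeeze t ` int_span2 A B"
    then show "w \<in> int_span2 (squeeze t A) (squeeze t B)"
      unfolding int_span2_def by (auto simp: squeeze_combination) blast
  next
    fix w assume "w \<in> int_span2 (squeeze t A) (squeeze t B)"
    then obtain m n where "w = of_int m *\<^sub>R squeeze t A + of_int n *\<^sub>R squeeze t B"
      unfolding int_span2_def by blast
    then have "w = squeeze t (of_int m *\<^sub>R A + of_int n *\<^sub>R B)"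
      by (simp only: squeeze_combination)
    then show "w \<in> squeeze t ` int_span2 A B" using int_span2_intro by blast
  qed
  moreover have "wedge (squeeze t A) (squeeze t B) = wedge A B"
    using assms(2) by (simp add: wedge_def)
  ultimately show ?thesis using assms(1) by (simp add: lattice_basis_def)
qed

lemma admissible_squeeze:
  assumes L: "lattice_basis \<Lambda> A B" and t: "t > 0" and adm: "admissible \<Lambda> x y"
  shows "admissible (squeeze t ` \<Lambda>) (t * x) (y / t)"
  unfolding admissible_iff[OF lattice_zero[OF lattice_basis_squeeze[OF L t]]]
proof (intro conjI ballI impI)
  note a = adm[unfolded admissible_iff[OF lattice_zero[OF L]]]
  show "t * x > 0" "y / t > 0" using a t by auto
  fix v assume v: "v \<in> squeeze t ` \<Lambda>" "0 \<le> v$1" "v$1 \<le> t * x" "0 \<le> v$2" "v$2 \<le> y / t"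
  then obtain u where u: "u \<in> \<Lambda>" "v = squeeze t u" by blast
  have "u = 0"
    using a u v t by (auto simp: zero_le_mult_iff zero_le_divide_iff divide_le_cancel)
  then show "v = 0" using u by (simp add: vec2_eq_0_iff)
qed

text \<open>
  Applied also to the inverse map \<open>squeeze (1 / t)\<close>, this inequality becomes an equality.
\<close>

lemma kappa_plus_squeeze_ge:
  assumes "lattice_basis \<Lambda> A B" "t > 0"
  shows "kappa_plus \<Lambda> \<le> kappa_plus (squeeze t ` \<Lambda>)"
proof (rule kappa_plus_le)
  fix x y assume "admissible \<Lambda> x y"
  from kappa_plus_ge[OF admissible_squeeze[OF assms this]]
  show "ennreal (x * y) \<le> kappa_plus (squeeze t ` \<Lambda>)" using assms(2) by simp
qed

lemma kappa_plus_squeeze: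
  assumes L: "lattice_basis \<Lambda> A B" and t: "t > 0"
  shows "kappa_plus (squeeze t ` \<Lambda>) = kappa_plus \<Lambda>"
proof (rule antisym)
  have "squeeze (1 / t) (squeeze t v) = v" for v
    using t by (simp add: vec_eq_iff forall_2)
  then have "squeeze (1 / t) ` squeeze t ` \<Lambda> = \<Lambda>" by (simp add: image_image)
  then show "kappa_plus (squeeze t ` \<Lambda>) \<le> kappa_plus \<Lambda>"
    using kappa_plus_squeeze_ge[OF lattice_basis_squeeze[OF L t], of "1 / t"] t by simp
qed (rule kappa_plus_squeeze_ge[OF assms])

lemma obtain_admissible_square:
  assumes "unimodular_lattice \<Lambda>" "admissible \<Lambda> x y"
  obtains \<Lambda>' where "unimodular_lattice \<Lambda>'" "kappa_plus \<Lambda>' = kappa_plus \<Lambda>"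
    "admissible \<Lambda>' (sqrt (x * y)) (sqrt (x * y))"
proof -
  obtain A B where L: "lattice_basis \<Lambda> A B"
    using assms(1) unimodular_lattice_iff_basis by blast
  have xy: "x > 0" "y > 0" using assms(2) by (auto simp: admissible_def)
  define t where "t = sqrt (y / x)"
  have t: "t > 0" using xy by (simp add: t_def)
  have "t * x = sqrt (x * y)" "y / t = sqrt (x * y)"
    using xy by (simp_all add: t_def real_sqrt_divide real_sqrt_mult field_simps)
  then have "admissible (squeeze t ` \<Lambda>) (sqrt (x * y)) (sqrt (x * y))"
    using admissible_squeeze[OF L t assms(2)] by simp
  moreover have "unimodular_lattice (squeeze t ` \<Lambda>)"
    using lattice_basis_squeeze[OF L t] unimodular_lattice_iff_basis by blast
  ultimately show ?thesis using that kappa_plus_squeeze[OF L t] by blast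
qed

section \<open>Limits of lattices\<close>

text \<open>
  A lattice vector in a fixed box has coefficients bounded in terms of the lengths of the basis vectors, so
  for all \<open>n\<close> at once only finitely many coefficient pairs matter. For each nonzero pair the corresponding
  vector of the limit lattice lies in the open complement of the box, hence so do the approximating ones.
\<close>

lemma eventually_admissible:
  assumes A: "A \<longlonglongrightarrow> A'" and B: "B \<longlonglongrightarrow> B'"
    and unit: "\<And>n. \<bar>wedge (A n) (B n)\<bar> = 1"
    and adm: "admissible (int_span2 A' B') x y"
  shows "\<forall>\<^sub>F n in sequentially. admissible (int_span2 (A n) (B n)) x y"
proof -
  note a = adm[unfolded admissible_iff[OF zero_in_int_span2]]
  have xy: "x > 0" "y > 0" using a by auto
  have unit': "\<bar>wedge A' B'\<bar> = 1"
    using LIMSEQ_unique[OF tendsto_rabs[OF tendsto_wedge[OF A B]]] by (simp add: unit)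
  obtain R where R: "\<And>n. norm (A n) \<le> R" "\<And>n. norm (B n) \<le> R"
  proof -
    obtain R1 R2 where "\<And>n. norm (A n) \<le> R1" "\<And>n. norm (B n) \<le> R2"
      using A B convergent_imp_Bseq convergentI BseqE by metis
    then show ?thesis using that[of "max R1 R2"] by (simp add: le_max_iff_disj)
  qed
  define M where "M = \<lceil>(x + y) * R\<rceil>"
  define F where "F = ({-M..M} \<times> {-M..M}) - {(0, 0)}"
  have "\<forall>\<^sub>F n in sequentially. \<forall>p\<in>F. of_int (fst p) *\<^sub>R A n + of_int (snd p) *\<^sub>R B n
      \<notin> cbox 0 (vector [x, y])"
  proof (rule eventually_ball_finite)
    show "finite F" by (simp add: F_def)
    show "\<forall>p\<in>F. \<forall>\<^sub>F n in sequentially. of_int (fst p) *\<^sub>R A n + of_int (snd p) *\<^sub>R B n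
      \<notin> cbox 0 (vector [x, y])"
    proof
      fix p assume p: "p \<in> F"
      define v where "v = of_int (fst p) *\<^sub>R A' + of_int (snd p) *\<^sub>R B'"
      have "v \<noteq> 0"
      proof
        assume "v = 0"
        then have "wedge v B' = 0" "wedge A' v = 0" by (auto simp: wedge_def)
        then have "fst p = 0" "snd p = 0"
          using unit' unfolding v_def wedge_coordinates by auto
        then show False using p by (auto simp: F_def prod_eq_iff)
      qed
      moreover have "v \<in> int_span2 A' B'" unfolding v_def by (rule int_span2_intro)
      ultimately have "v \<in> - cbox 0 (vector [x, y])"
        using a by (auto simp: mem_cbox_quadrant)
      moreover have "(\<lambda>n. of_int (fst p) *\<^sub>R A n + of_int (snd p) *\<^sub>R B n) \<longlonglongrightarrow> v"
        unfolding v_def by (intro tendsto_intros A B)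
      ultimately have "\<forall>\<^sub>F n in sequentially. of_int (fst p) *\<^sub>R A n + of_int (snd p) *\<^sub>R B n
          \<in> - cbox 0 (vector [x, y])"
        by (intro topological_tendstoD) auto
      then show "\<forall>\<^sub>F n in sequentially. of_int (fst p) *\<^sub>R A n + of_int (snd p) *\<^sub>R B n
          \<notin> cbox 0 (vector [x, y])" by simp
    qed
  qed
  then show ?thesis
  proof (rule eventually_mono)
    fix n assume n: "\<forall>p\<in>F. of_int (fst p) *\<^sub>R A n + of_int (snd p) *\<^sub>R B n
      \<notin> cbox 0 (vector [x, y])"
    show "admissible (int_span2 (A n) (B n)) x y"
      unfolding admissible_iff[OF zero_in_int_span2]
    proof (intro conjI ballI impI xy)
      fix v assume v: "v \<in> int_span2 (A n) (B n)" "0 \<le> v$1" "v$1 \<le> x" "0 \<le> v$2" "v$2 \<le> y"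
      then obtain k l where kl: "v = of_int k *\<^sub>R A n + of_int l *\<^sub>R B n"
        unfolding int_span2_def by blast
      have R0: "0 \<le> R" using R(1) norm_ge_zero order_trans by blast
      have bound: "\<bar>wedge v w\<bar> \<le> of_int M" if "norm w \<le> R" for w
      proof -
        have "\<bar>wedge v w\<bar> \<le> (\<bar>v$1\<bar> + \<bar>v$2\<bar>) * norm w" by (rule abs_wedge_le)
        also have "\<dots> \<le> (x + y) * R" using v that xy by (intro mult_mono) auto
        also have "\<dots> \<le> of_int M" unfolding M_def by (rule le_of_int_ceiling)
        finally show ?thesis .
      qed
      have "\<bar>real_of_int k\<bar> = \<bar>wedge v (B n)\<bar>"
        unfolding kl wedge_coordinates by (simp add: abs_mult unit)
      moreover have "\<bar>real_of_int l\<bar> = \<bar>wedge v (A n)\<bar>"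
      proof -
        have "wedge v (A n) = - wedge (A n) v" by (simp add: wedge_def)
        then show ?thesis unfolding kl wedge_coordinates by (simp add: abs_mult unit)
      qed
      ultimately have "\<bar>real_of_int k\<bar> \<le> of_int M" "\<bar>real_of_int l\<bar> \<le> of_int M"
        using bound R by auto
      then have "\<bar>k\<bar> \<le> M" "\<bar>l\<bar> \<le> M" by linarith+
      moreover have "(k, l) \<notin> F"
      proof
        assume "(k, l) \<in> F"
        with n kl have "v \<notin> cbox 0 (vector [x, y])" by force
        then show False using v by (simp add: mem_cbox_quadrant)
      qed
      ultimately have "k = 0 \<and> l = 0" by (auto simp: F_def)
      then show "v = 0" using kl by simp
    qed
  qed
qed

text \<open>
  Lower semicontinuity holds for every convergent sequence of lattices. The reverse inequality uses that
  the squares with side \<open>r n\<close> are nearly optimal. A nonzero vector \<open>v\<close> of the limit lattice in a smaller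
  square is the limit of vectors \<open>w n\<close> that the admissible squares must exclude, which is possible only
  if \<open>v\<close> is on an axis and \<open>w n\<close> lies just beyond it; mixed-sign vectors so close to an axis are
  incompatible with bounded \<open>\<kappa>\<^sup>+\<close>.
\<close>

lemma kappa_plus_limit:
  assumes A: "A \<longlonglongrightarrow> A'" and B: "B \<longlonglongrightarrow> B'"
    and unit: "\<And>n. \<bar>wedge (A n) (B n)\<bar> = 1"
    and lim: "(\<lambda>n. kappa_plus (int_span2 (A n) (B n))) \<longlonglongrightarrow> ennreal S" and S: "S > 0"
    and adm: "\<And>n. admissible (int_span2 (A n) (B n)) (r n) (r n)"
    and r: "r \<longlonglongrightarrow> sqrt S"
  shows "kappa_plus (int_span2 A' B') = ennreal S"
proof (rule antisym)
  show "kappa_plus (int_span2 A' B') \<le> ennreal S"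
  proof (rule kappa_plus_le)
    fix x y assume "admissible (int_span2 A' B') x y"
    from eventually_admissible[OF A B unit this]
    have "\<forall>\<^sub>F n in sequentially. ennreal (x * y) \<le> kappa_plus (int_span2 (A n) (B n))"
      by (rule eventually_mono) (rule kappa_plus_ge)
    then show "ennreal (x * y) \<le> ennreal S" using lim by (intro tendsto_lowerbound) auto
  qed
next
  have basis: "lattice_basis (int_span2 (A n) (B n)) (A n) (B n)" for n
    by (simp add: lattice_basis_def unit)
  have "\<forall>\<^sub>F n in sequentially. kappa_plus (int_span2 (A n) (B n)) < ennreal (S + 1)"
    using S by (intro order_tendstoD(2)[OF lim]) (simp add: ennreal_less_iff)
  then have bd: "\<forall>\<^sub>F n in sequentially. kappa_plus (int_span2 (A n) (B n)) \<le> ennreal (S + 1)"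
    by (rule eventually_mono) simp
  have adm': "admissible (int_span2 A' B') x x" if x: "0 < x" "x < sqrt S" for x
    unfolding admissible_iff[OF zero_in_int_span2]
  proof (intro conjI ballI impI x)
    fix v assume v: "v \<in> int_span2 A' B'" "0 \<le> v$1" "v$1 \<le> x" "0 \<le> v$2" "v$2 \<le> x"
    show "v = 0"
    proof (rule ccontr)
      assume "v \<noteq> 0"
      then have pos: "v$1 > 0 \<or> v$2 > 0" using v by (auto simp: vec2_eq_0_iff)
      obtain k l where kl: "v = of_int k *\<^sub>R A' + of_int l *\<^sub>R B'"
        using v unfolding int_span2_def by blast
      define w where "w n = of_int k *\<^sub>R A n + of_int l *\<^sub>R B n" for n
      have w: "w \<longlonglongrightarrow> v" unfolding kl w_def by (intro tendsto_intros A B)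
      have wi: "(\<lambda>n. w n $ i) \<longlonglongrightarrow> v $ i" for i by (intro tendsto_intros w)
      have wm: "w n \<in> int_span2 (A n) (B n)" for n unfolding w_def by (rule int_span2_intro)
      have "\<forall>\<^sub>F n in sequentially. w n $ i < r n" if "v $ i \<le> x" for i
      proof -
        have "(\<lambda>n. r n - w n $ i) \<longlonglongrightarrow> sqrt S - v $ i" by (intro tendsto_intros r wi)
        then have "\<forall>\<^sub>F n in sequentially. 0 < r n - w n $ i"
          using that x by (intro order_tendstoD(1)[where y = "sqrt S - v $ i"]) auto
        then show ?thesis by simp
      qed
      then have e1: "\<forall>\<^sub>F n in sequentially. w n $ 1 < r n" "\<forall>\<^sub>F n in sequentially. w n $ 2 < r n"
        using v by auto
      have e2: "\<forall>\<^sub>F n in sequentially. w n $ 1 > 0 \<or> w n $ 2 > 0"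
        using pos
      proof
        assume "v$1 > 0"
        from order_tendstoD(1)[OF wi this] show ?thesis by (rule eventually_mono) simp
      next
        assume "v$2 > 0"
        from order_tendstoD(1)[OF wi this] show ?thesis by (rule eventually_mono) simp
      qed
      have e3: "\<forall>\<^sub>F n in sequentially. w n $ 1 < 0 \<or> w n $ 2 < 0"
        using e1 e2
      proof eventually_elim
        case (elim n)
        have "w n \<noteq> 0" using elim by auto
        then show ?case
          using adm[of n, unfolded admissible_iff[OF zero_in_int_span2]] wm[of n] elim
          by (meson less_imp_le not_le)
      qed
      have "\<forall>\<^sub>F n in sequentially. w n $ 1 * w n $ 2 \<le> - 1 / (4 * (S + 1))"
        using e1 e2 e3 bd
      proof eventually_elim
        case (elim n)
        then have "w n $ 1 * w n $ 2 < 0" by (auto simp: mult_less_0_iff)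
        from mixed_sign_product_ge[OF basis wm this elim(5)] show ?case using S by simp
      qed
      moreover have "(\<lambda>n. w n $ 1 * w n $ 2) \<longlonglongrightarrow> v$1 * v$2" by (intro tendsto_intros wi)
      ultimately have "v$1 * v$2 \<le> - 1 / (4 * (S + 1))"
        by (intro tendsto_upperbound[of _ _ sequentially]) auto
      moreover have "- 1 / (4 * (S + 1)) < 0" using S by simp
      moreover have "0 \<le> v$1 * v$2" using v by simp
      ultimately show False by linarith
    qed
  qed
  show "ennreal S \<le> kappa_plus (int_span2 A' B')"
  proof (rule ccontr)
    assume "\<not> ?thesis"
    then have lt: "kappa_plus (int_span2 A' B') < ennreal S" by simp
    define l where "l = enn2real (kappa_plus (int_span2 A' B'))"
    have kl: "kappa_plus (int_span2 A' B') = ennreal l" "l \<ge> 0"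
      using lt unfolding l_def by (auto simp: ennreal_enn2real_if top_unique)
    then have "l < S" using lt by (simp add: ennreal_less_iff)
    define x where "x = sqrt ((l + S) / 2)"
    have x: "0 < x" "x < sqrt S" "x * x = (l + S) / 2"
      using \<open>l < S\<close> kl S by (auto simp: x_def)
    from kappa_plus_ge[OF adm'[OF x(1,2)]] have "(l + S) / 2 \<le> l"
      unfolding x(3) kl(1) using kl by simp
    then show False using \<open>l < S\<close> by simp
  qed
qed

section \<open>Compactness for finite limit values\<close>

text \<open>
  Mixed-sign vectors \<open>v\<close> satisfy \<open>\<bar>v\<bar>\<^sup>2 \<ge> 2 \<bar>v\<^sub>1 v\<^sub>2\<bar> \<ge> 1 / (2 C)\<close>; all others have a representative up to sign
  in the closed quadrant, which the square excludes.
\<close>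

lemma norm_sq_ge_of_admissible_square:
  assumes L: "lattice_basis \<Lambda> A B" and v: "v \<in> \<Lambda>" "v \<noteq> 0"
    and K: "kappa_plus \<Lambda> \<le> ennreal C" "C > 0" and adm: "admissible \<Lambda> r r"
  shows "min (r\<^sup>2) (1 / (2 * C)) \<le> v \<bullet> v"
proof (cases "v$1 * v$2 < 0")
  case True
  have "v$1 * v$2 \<le> - 1 / (4 * C)" using mixed_sign_product_ge[OF L v(1) True K] .
  moreover have "0 \<le> (v$1 + v$2)\<^sup>2" by simp
  then have "- 2 * (v$1 * v$2) \<le> v \<bullet> v"
    by (simp add: inner_2 power2_sum) (simp add: power2_eq_square)
  ultimately show ?thesis by simp
next
  case False
  note a = adm[unfolded admissible_iff[OF lattice_zero[OF L]]]
  define u where "u = (if v$1 < 0 \<or> v$2 < 0 then - v else v)"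
  have u: "u \<in> \<Lambda>" "u \<noteq> 0" "0 \<le> u$1" "0 \<le> u$2"
    using False v lattice_uminus[OF L] by (auto simp: u_def not_less zero_le_mult_iff)
  then have "r < u$1 \<or> r < u$2" using a not_le by blast
  then have "r\<^sup>2 < (u$1)\<^sup>2 \<or> r\<^sup>2 < (u$2)\<^sup>2"
    using a by (auto intro: power_strict_mono)
  then have "r\<^sup>2 \<le> (u$1)\<^sup>2 + (u$2)\<^sup>2" by (smt (verit) zero_le_power2)
  also have "\<dots> = v \<bullet> v" by (simp add: inner_2 u_def power2_eq_square)
  finally show ?thesis by simp
qed

lemma bounded_basis:
  assumes "unimodular_lattice \<Lambda>" and short: "\<And>v. v \<in> \<Lambda> \<Longrightarrow> v \<noteq> 0 \<Longrightarrow> d \<le> v \<bullet> v" and d: "d > 0"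
  obtains A B where "lattice_basis \<Lambda> A B" "A \<bullet> A \<le> 2" "B \<bullet> B \<le> 2 / d"
proof -
  obtain A B where L: "lattice_basis \<Lambda> A B" and A: "A \<bullet> A \<le> 2" "\<bar>A \<bullet> B\<bar> \<le> (A \<bullet> A) / 2"
    using reduced_basis[OF assms(1)] .
  have "A \<in> \<Lambda>" using L int_span2_intro[of 1 A 0 B] by (simp add: lattice_basis_def)
  moreover have "A \<noteq> 0" using L by (auto simp: lattice_basis_def wedge_def)
  ultimately have dA: "d \<le> A \<bullet> A" using short by blast
  have "(wedge A B)\<^sup>2 = 1" using L by (metis lattice_basis_def one_power2 power2_abs)
  moreover have "\<bar>A \<bullet> B\<bar>\<^sup>2 \<le> 1\<^sup>2" using A by (intro power_mono) auto
  ultimately have "(A \<bullet> A) * (B \<bullet> B) \<le> 2" unfolding lagrange_identity_2 by simp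
  moreover have "d * (B \<bullet> B) \<le> (A \<bullet> A) * (B \<bullet> B)" using dA by (intro mult_right_mono) auto
  ultimately have "B \<bullet> B \<le> 2 / d" using d by (simp add: field_simps)
  then show ?thesis using that L A by blast
qed

text \<open>
  The factor \<open>1 - 1 / (n + 2)\<close> below makes the chosen rectangles asymptotically optimal while it
  stays at least \<open>1/2\<close>, so that all squares have area at least \<open>1/8\<close> and the lattices have uniformly
  bounded bases.
\<close>

lemma finite_limit_in_MG2_plus:
  assumes X: "\<And>n. X n \<in> MG2_plus" and lim: "X \<longlonglongrightarrow> ennreal S" and S0: "S \<ge> 0"
  shows "ennreal S \<in> MG2_plus"
proof -
  have "ennreal (1/4) \<le> X n" for n
    using X[of n] kappa_plus_ge_quarter unfolding MG2_plus_def by auto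
  then have "ennreal (1/4) \<le> ennreal S" using lim by (intro tendsto_lowerbound[OF lim]) auto
  then have S: "S \<ge> 1/4" using S0 by simp
  have "\<forall>\<^sub>F n in sequentially. X n < ennreal (S + 1)"
    using S by (intro order_tendstoD(2)[OF lim]) (simp add: ennreal_less_iff)
  then obtain N where N: "\<And>n. n \<ge> N \<Longrightarrow> X n < ennreal (S + 1)"
    unfolding eventually_sequentially by blast
  define k where "k n = enn2real (X (n + N))" for n
  have Xk: "X (n + N) = ennreal (k n)" for n
    using N[of "n + N"] unfolding k_def by (auto simp: ennreal_enn2real_if top_unique)
  have k: "1/4 \<le> k n" "k n \<le> S + 1" for n
  proof -
    have "k n \<ge> 0" by (simp add: k_def)
    then show "1/4 \<le> k n" "k n \<le> S + 1"
      using \<open>ennreal (1/4) \<le> X (n + N)\<close> N[of "n + N"] S unfolding Xk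
      by (auto simp: ennreal_less_iff simp del: ennreal_plus)
  qed
  have klim: "k \<longlonglongrightarrow> S"
  proof -
    have "(\<lambda>n. ennreal (k n)) \<longlonglongrightarrow> ennreal S"
      using LIMSEQ_ignore_initial_segment[OF lim, of N] by (simp add: Xk)
    moreover have "\<forall>\<^sub>F n in sequentially. 0 \<le> k n" by (simp add: k_def)
    ultimately show ?thesis using S0 tendsto_ennreal_iff by blast
  qed
  have "\<exists>\<Lambda> r. unimodular_lattice \<Lambda> \<and> kappa_plus \<Lambda> = ennreal (k n) \<and> admissible \<Lambda> r r
      \<and> (1 - 1 / real (n + 2)) * k n \<le> r\<^sup>2 \<and> r\<^sup>2 \<le> k n" for n
  proof -
    obtain \<Lambda> where L: "unimodular_lattice \<Lambda>" "kappa_plus \<Lambda> = ennreal (k n)"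
      using X[of "n + N"] unfolding MG2_plus_def Xk by auto
    have "(1 - 1 / real (n + 2)) * k n < k n" "0 \<le> (1 - 1 / real (n + 2)) * k n"
      using k(1)[of n] by (auto simp: field_simps)
    then have "ennreal ((1 - 1 / real (n + 2)) * k n) < kappa_plus \<Lambda>"
      by (simp add: L ennreal_less_iff)
    then obtain x y where xy: "admissible \<Lambda> x y" "ennreal ((1 - 1 / real (n + 2)) * k n) < ennreal (x * y)"
      by (rule less_kappa_plusD)
    have pos: "x > 0" "y > 0" using xy(1) by (auto simp: admissible_def)
    have lo: "(1 - 1 / real (n + 2)) * k n < x * y"
      using xy(2) \<open>0 \<le> (1 - 1 / real (n + 2)) * k n\<close> by (simp add: ennreal_less_iff)
    from kappa_plus_ge[OF xy(1)] have hi: "x * y \<le> k n"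
      unfolding L(2) using k(1)[of n] by simp
    obtain \<Lambda>' where "unimodular_lattice \<Lambda>'" "kappa_plus \<Lambda>' = kappa_plus \<Lambda>"
      "admissible \<Lambda>' (sqrt (x * y)) (sqrt (x * y))"
      using obtain_admissible_square[OF L(1) xy(1)] .
    then show ?thesis using lo hi pos L(2)
      by (intro exI[of _ \<Lambda>'] exI[of _ "sqrt (x * y)"]) auto
  qed
  then obtain \<Lambda> r where \<Lambda>: "\<And>n. unimodular_lattice (\<Lambda> n)"
      "\<And>n. kappa_plus (\<Lambda> n) = ennreal (k n)" "\<And>n. admissible (\<Lambda> n) (r n) (r n)"
    and r: "\<And>n. (1 - 1 / real (n + 2)) * k n \<le> (r n)\<^sup>2" "\<And>n. (r n)\<^sup>2 \<le> k n"
    by metis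
  have rpos: "r n > 0" for n using \<Lambda>(3)[of n] by (simp add: admissible_def)
  have "(\<lambda>n. 1 - 1 / real (n + 2)) \<longlonglongrightarrow> 1 - 0"
    by (intro tendsto_diff tendsto_const LIMSEQ_ignore_initial_segment[of "\<lambda>n. 1 / real n"] lim_1_over_n)
  from tendsto_mult[OF this klim] have "(\<lambda>n. (1 - 1 / real (n + 2)) * k n) \<longlonglongrightarrow> S" by simp
  then have "(\<lambda>n. (r n)\<^sup>2) \<longlonglongrightarrow> S"
    by (rule real_tendsto_sandwich[OF _ _ _ klim, rotated 2]) (use r in auto)
  from tendsto_real_sqrt[OF this] have rlim: "r \<longlonglongrightarrow> sqrt S"
    using rpos by (simp add: less_imp_le)
  define d where "d = min (1/8) (1 / (2 * (S + 1)))"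
  have d: "d > 0" using S by (simp add: d_def)
  have short: "d \<le> v \<bullet> v" if v: "v \<in> \<Lambda> n" "v \<noteq> 0" for v n
  proof -
    obtain A B where L: "lattice_basis (\<Lambda> n) A B"
      using \<Lambda>(1) unimodular_lattice_iff_basis by blast
    have le: "kappa_plus (\<Lambda> n) \<le> ennreal (S + 1)" unfolding \<Lambda>(2) using k by (intro ennreal_leI) auto
    have "min ((r n)\<^sup>2) (1 / (2 * (S + 1))) \<le> v \<bullet> v"
      using norm_sq_ge_of_admissible_square[OF L v le _ \<Lambda>(3)] S by simp
    moreover have "1/8 \<le> (r n)\<^sup>2"
    proof -
      have "1/8 = 1/2 * (1/4 :: real)" by simp
      also have "\<dots> \<le> (1 - 1 / real (n + 2)) * k n"
        using k(1)[of n] by (intro mult_mono) (auto simp: field_simps)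
      also have "\<dots> \<le> (r n)\<^sup>2" by (rule r(1))
      finally show ?thesis .
    qed
    ultimately show ?thesis unfolding d_def by linarith
  qed
  have "\<exists>A B. lattice_basis (\<Lambda> n) A B \<and> A \<bullet> A \<le> 2 \<and> B \<bullet> B \<le> 2 / d" for n
    using bounded_basis[OF \<Lambda>(1)[of n] short[of _ n] d] by blast
  then obtain A B where AB: "\<And>n. lattice_basis (\<Lambda> n) (A n) (B n)"
      "\<And>n. A n \<bullet> A n \<le> 2" "\<And>n. B n \<bullet> B n \<le> 2 / d" by metis
  have "(A n, B n) \<in> cball 0 (sqrt 2) \<times> cball 0 (sqrt (2 / d))" for n
    using AB(2,3)[of n] by (simp add: norm_eq_sqrt_inner)
  moreover have "compact (cball (0 :: real^2) (sqrt 2) \<times> cball (0 :: real^2) (sqrt (2 / d)))"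
    by (intro compact_Times compact_cball)
  ultimately obtain l \<phi> where \<phi>: "strict_mono \<phi>" "((\<lambda>n. (A n, B n)) \<circ> \<phi>) \<longlonglongrightarrow> l"
    unfolding compact_def by (metis (no_types, lifting))
  obtain A' B' where "l = (A', B')" by force
  then have lims: "(\<lambda>n. A (\<phi> n)) \<longlonglongrightarrow> A'" "(\<lambda>n. B (\<phi> n)) \<longlonglongrightarrow> B'"
    using tendsto_fst[OF \<phi>(2)] tendsto_snd[OF \<phi>(2)] by (auto simp: o_def)
  have unit: "\<bar>wedge (A n) (B n)\<bar> = 1" and \<Lambda>eq: "int_span2 (A n) (B n) = \<Lambda> n" for n
    using AB(1)[of n] by (auto simp: lattice_basis_def)
  have "kappa_plus (int_span2 A' B') = ennreal S"
  proof (rule kappa_plus_limit[OF lims])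
    show "(\<lambda>n. kappa_plus (int_span2 (A (\<phi> n)) (B (\<phi> n)))) \<longlonglongrightarrow> ennreal S"
      unfolding \<Lambda>eq \<Lambda>(2)
      using LIMSEQ_subseq_LIMSEQ[OF tendsto_ennrealI[OF klim] \<phi>(1)] by (simp add: o_def)
    show "(\<lambda>n. r (\<phi> n)) \<longlonglongrightarrow> sqrt S"
      using LIMSEQ_subseq_LIMSEQ[OF rlim \<phi>(1)] by (simp add: o_def)
  qed (use S unit \<Lambda>eq \<Lambda>(3) in auto)
  moreover have "\<bar>wedge A' B'\<bar> = 1"
    using LIMSEQ_unique[OF tendsto_rabs[OF tendsto_wedge[OF lims]]] by (simp add: unit)
  then have "unimodular_lattice (int_span2 A' B')"
    unfolding unimodular_lattice_iff_basis lattice_basis_def by blast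
  ultimately show ?thesis unfolding MG2_plus_def by force
qed

section \<open>A lattice with infinite value\<close>

text \<open>
  For each bound \<open>1 / (N + 1)\<close> the numbers satisfying the condition form an open set, which is dense because it
  contains all numbers slightly above any given fraction; the Baire category theorem provides a common
  element of these sets.
\<close>

lemma ex_well_approximable_from_below:
  "\<exists>\<theta>::real. \<forall>N::nat. \<exists>(n::int) (m::int). 0 < n * (n * \<theta> - m) \<and> n * (n * \<theta> - m) < 1 / (real N + 1)"
proof -
  define U :: "nat \<Rightarrow> real set" where
    "U N = (\<Union>n::int. \<Union>m::int. {\<theta>. 0 < n * (n * \<theta> - m)} \<inter> {\<theta>. n * (n * \<theta> - m) < 1 / (real N + 1)})" for N
  have "UNIV \<subseteq> closure (\<Inter>(range U))"
  proof (rule Baire)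
    fix T assume "T \<in> range U"
    then obtain N where T: "T = U N" by blast
    have "open (U N)" unfolding U_def
      by (intro open_UN ballI open_Int open_Collect_less continuous_intros)
    moreover have "x \<in> closure (U N)" for x
      unfolding closure_approachable
    proof (intro allI impI)
      fix e :: real assume e: "e > 0"
      obtain j :: nat where j: "inverse (of_nat (Suc j)) < e / 2"
        using reals_Archimedean[of "e / 2"] e by auto
      define n where "n = int (Suc j)"
      define m where "m = \<lfloor>n * x\<rfloor>"
      have n: "real_of_int n > 0" "1 / real_of_int n < e / 2"
        using j by (auto simp: n_def inverse_eq_divide)
      \<comment> \<open>The second argument of min keeps n times (n y - m), which is h times the square of n, at most half of the required bound.\<close>
      define h where "h = min (e / 2) (1 / (2 * (real_of_int n)\<^sup>2 * (real N + 1)))"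
      have h: "0 < h" "h \<le> e / 2" using e n by (auto simp: h_def)
      define y where "y = m / n + h"
      have ny: "n * (n * y - m) = (real_of_int n)\<^sup>2 * h"
        using n by (simp add: y_def field_simps power2_eq_square)
      have "(real_of_int n)\<^sup>2 * h \<le> (real_of_int n)\<^sup>2 * (1 / (2 * (real_of_int n)\<^sup>2 * (real N + 1)))"
        by (intro mult_left_mono) (auto simp: h_def)
      also have "\<dots> = 1 / (real N + 1) / 2" using n by simp
      also have "\<dots> < 1 / (real N + 1)"
        by (simp add: field_simps)
      finally have "y \<in> U N" unfolding U_def using ny n h 
        by (intro UN_I[of n] UN_I[of m] IntI CollectI UNIV_I) auto
      moreover have "dist y x < e"
      proof -
        have "m \<le> n * x" "n * x < m + 1" unfolding m_def by linarith+
        then have "m / n \<le> x" "x < m / n + 1 / n" using n by (auto simp: field_simps)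
        then show ?thesis using h n by (simp add: dist_real_def y_def)
      qed
      ultimately show "\<exists>y\<in>U N. dist y x < e" by blast
    qed
    ultimately show "openin (top_of_set UNIV) T \<and> UNIV \<subseteq> closure T" by (auto simp: T)
  qed auto
  then have "\<Inter>(range U) \<noteq> {}" by auto
  then obtain \<theta> where "\<And>N. \<theta> \<in> U N" by blast
  then show ?thesis unfolding U_def by (intro exI[of _ \<theta>] allI) simp
qed

lemma top_in_MG2_plus: "top \<in> MG2_plus"
proof -
  obtain \<theta> :: real where \<theta>:
    "\<And>N::nat. \<exists>(n::int) (m::int). 0 < n * (n * \<theta> - m) \<and> n * (n * \<theta> - m) < 1 / (real N + 1)"
    using ex_well_approximable_from_below by blast
  define A B :: "real^2" where "A = vector [\<theta>, - 1]" and "B = vector [- 1, 0]"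
  define \<Lambda> where "\<Lambda> = int_span2 A B"
  have L: "lattice_basis \<Lambda> A B"
    by (simp add: lattice_basis_def \<Lambda>_def wedge_def A_def B_def)
  \<comment> \<open>The vector n A + m B is (n \<theta> - m, - n), so its coordinates have product - n (n \<theta> - m).\<close>
  have "kappa_plus \<Lambda> = top"
  proof (rule ccontr)
    assume "kappa_plus \<Lambda> \<noteq> top"
    define C where "C = enn2real (kappa_plus \<Lambda>) + 1"
    have C: "kappa_plus \<Lambda> \<le> ennreal C" "C > 0"
      using \<open>kappa_plus \<Lambda> \<noteq> top\<close> by (auto simp: C_def ennreal_enn2real_if intro: enn2real_le add_nonneg_pos)
    obtain N :: nat where N: "4 * C < N" using reals_Archimedean2 by blast
    obtain n :: int and m :: int where nm: "0 < n * (n * \<theta> - m)" "n * (n * \<theta> - m) < 1 / (real N + 1)"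
      using \<theta> by blast
    define v where "v = of_int n *\<^sub>R A + of_int m *\<^sub>R B"
    have v: "v \<in> \<Lambda>" unfolding v_def \<Lambda>_def by (rule int_span2_intro)
    have vv: "v$1 * v$2 = - (n * (n * \<theta> - m))"
      by (simp add: v_def A_def B_def algebra_simps)
    have "v$1 * v$2 \<le> - 1 / (4 * C)"
      using mixed_sign_product_ge[OF L v _ C] nm vv by simp
    then have "1 / (4 * C) < 1 / (real N + 1)" using nm vv by simp
    moreover have "1 / (real N + 1) \<le> 1 / (4 * C)" using N C by (intro divide_left_mono) auto
    ultimately show False by simp
  qed
  moreover have "unimodular_lattice \<Lambda>" using L unimodular_lattice_iff_basis by blast
  ultimately show ?thesis unfolding MG2_plus_def by force
qed

section \<open>Closedness of the spectrum\<close>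

theorem theorem54:
  shows "closed MG2_plus"
  unfolding closed_sequential_limits
proof (intro allI impI)
  fix X l assume "(\<forall>n. X n \<in> MG2_plus) \<and> X \<longlonglongrightarrow> l"
  then show "l \<in> MG2_plus"
    using top_in_MG2_plus finite_limit_in_MG2_plus[of X] by (cases l) auto
qed

end
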